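(* Let $h\in\mathbb{Z}$, $r\in\mathbb{N}$ and $n\in\mathbb{Z}_+$. Then $$\beta_{n,q}^{(h,r)}=(q-1)\beta_{n+1,q}^{(h-1,r)}+\beta_{n,q}^{(h-1,r)}$$ and $$\sum_{l=0}^n\binom nl(q-1)^l\beta_{l,q}^{(0,r)}=\frac{\binom{n-1}{r}}{\binom{n-1}{r}_q}\,\frac{r!}{[r]_q!}.$$ Furthermore, $$\sum_{l=0}^n\binom nl(q-1)^l\beta_{l,q}^{(h,1)}=\frac{n+h-1}{[n+h-1]_q}.$$
   Context: $p$ is a fixed prime, $\mathbb{N}=\{1,2,\dots\}$, $\mathbb{Z}_+=\mathbb{N}\cup\{0\}$, and $\mathbb{C}_p$ is the completion of an algebraic closure of $\mathbb{Q}_p$, with $|p|_p=p^{-1}$. $q\in\mathbb{C}_p$ satisfies $|1-q|_p<1$ and is not a root of unity. For $x\in\mathbb{Z}_p$, $q^x=\sum_{k\ge0}\binom xk(q-1)^k$ and $[x]_q=\frac{1-q^x}{1-q}$; $0^0=1$. $[r]_q!=[r]_q[r-1]_q\cdots[1]_q$, $\binom{m}{r}_q=\frac{[m]_q[m-1]_q\cdots[m-r+1]_q}{[r]_q!}$ and $\binom mr=\frac{m(m-1)\cdots(m-r+1)}{r!}$. The expression $\frac{\binom mr}{\binom mr_q}\frac{r!}{[r]_q!}$ means $\prod_{j=1}^r\frac{m-j+1}{[m-j+1]_q}$; any quotient $\frac{0}{[0]_q}$ is read as its limiting value $\frac{q-1}{\log q}$ ($\log$ the $p$-adic logarithm). The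 $p$-adic $q$-integral is $\int_{\mathbb{Z}_p}g(x)\,d\mu_q(x)=\lim_{N\to\infty}\frac{1}{[p^N]_q}\sum_{x=0}^{p^N-1}g(x)q^x$ (when the limit exists); multiple integrals are iterated. For $h\in\mathbb{Z}$, $r\in\mathbb{N}$, the $(h,q)$-Bernoulli numbers of order $r$ are $$\beta_{n,q}^{(h,r)}=\int_{\mathbb{Z}_p}\cdots\int_{\mathbb{Z}_p}q^{\sum_{j=1}^r(h-j-1)x_j}[x_1+\cdots+x_r]_q^n\,d\mu_q(x_1)\cdots d\mu_q(x_r)\quad(r\text{ integrals}).$$ *)

theory Defs
  imports "HOL-Analysis.Analysis" "HOL-Computational_Algebra.Computational_Algebra"
begin

definition Qp :: "'a::{field_char_0, metric_space} set" where
  "Qp = closure \<rat>"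

definition Qp_bar :: "'a::{field_char_0, metric_space} set" where
  "Qp_bar = {x. \<exists>f. f \<noteq> 0 \<and> set (coeffs f) \<subseteq> Qp \<and> poly f x = 0}"

(* The type 'a, with absolute value absp, is a copy of C_p: with the metric induced by absp
   it is complete, so the closure of the rationals in it is the p-adic completion Q_p; the
   elements algebraic over Q_p form an algebraic closure of Q_p, and they are dense.
   This determines 'a up to isometric isomorphism.  Since C_p is not a real vector space,
   the class real_normed_field cannot be used, whence the separate absolute value. *)
locale p_adic_complex =
  fixes p :: nat and absp :: "'a::{field_char_0, metric_space} \<Rightarrow> real"
  assumes prime_p: "prime p"
    and dist_absp: "dist x y = absp (x - y)"
    and absp_mult: "absp (x * y) = absp x * absp y"
    and absp_ultrametric: "absp (x + y) \<le> max (absp x) (absp y)"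
    and absp_p: "absp (of_nat p) = 1 / real p"
    and complete_UNIV: "complete (UNIV :: 'a set)"
    and Qp_bar_alg_closed:
      "set (coeffs (f :: 'a poly)) \<subseteq> Qp_bar \<Longrightarrow> degree f > 0 \<Longrightarrow> \<exists>z\<in>Qp_bar. poly f z = 0"
    and Qp_bar_dense: "closure (Qp_bar :: 'a set) = UNIV"

(* q^x for x in Z_p, where Z_p is regarded as a subset of C_p. *)
definition q_pow :: "'a::{field_char_0, metric_space} \<Rightarrow> 'a \<Rightarrow> 'a" where
  "q_pow q x = (\<Sum>k. (x gchoose k) * (q - 1) ^ k)"

definition q_num :: "'a::{field_char_0, metric_space} \<Rightarrow> 'a \<Rightarrow> 'a" where
  "q_num q x = (1 - q_pow q x) / (1 - q)"

definition p_adic_log :: "'a::{field_char_0, metric_space} \<Rightarrow> 'a" where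
  "p_adic_log z = (\<Sum>k. (-1) ^ k * (z - 1) ^ Suc k / of_nat (Suc k))"

(* m / [m]_q, which for m = 0 is read as the limit of x / [x]_q as x tends to 0 in Z_p *)
definition q_quot :: "'a::{field_char_0, metric_space} \<Rightarrow> int \<Rightarrow> 'a" where
  "q_quot q m = (if m = 0 then (q - 1) / p_adic_log q else of_int m / q_num q (of_int m))"

(* (binomial(m,r) / binomial(m,r)_q) * (r! / [r]_q!), with the factors r! and [r]_q!
   cancelled, so that it also makes sense when a factor of the numerators vanishes *)
definition q_binom_quot :: "'a::{field_char_0, metric_space} \<Rightarrow> int \<Rightarrow> nat \<Rightarrow> 'a" where
  "q_binom_quot q m r = (\<Prod>j=1..r. q_quot q (m - int j + 1))"

definition q_integral ::
  "nat \<Rightarrow> 'a::{field_char_0, metric_space} \<Rightarrow> ('a \<Rightarrow> 'a) \<Rightarrow> 'a" where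
  "q_integral p q g =
     lim (\<lambda>N. 1 / q_num q (of_nat (p ^ N)) *
               (\<Sum>x<p ^ N. g (of_nat x) * q_pow q (of_nat x)))"

(* The r-fold iterated integral of g(x_1, ..., x_r), with x_1 innermost and x_r outermost.
   The variables are packed into a function on indices, of which only 1, ..., r matter. *)
primrec q_integral_iter ::
  "nat \<Rightarrow> 'a::{field_char_0, metric_space} \<Rightarrow> nat \<Rightarrow> ((nat \<Rightarrow> 'a) \<Rightarrow> 'a) \<Rightarrow> 'a" where
  "q_integral_iter p q 0 g = g (\<lambda>_. 0)"
| "q_integral_iter p q (Suc r) g =
     q_integral p q (\<lambda>y. q_integral_iter p q r (\<lambda>x. g (x(Suc r := y))))"

definition q_bernoulli ::
  "nat \<Rightarrow> 'a::{field_char_0, metric_space} \<Rightarrow> int \<Rightarrow> nat \<Rightarrow> nat \<Rightarrow> 'a" where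
  "q_bernoulli p q h r n =
     q_integral_iter p q r
       (\<lambda>x. q_pow q (\<Sum>j=1..r. of_int (h - int j - 1) * x j) * q_num q (\<Sum>j=1..r. x j) ^ n)"

end

theory Submission
  imports Defs
begin

text \<open>
  At natural arguments the integrand defining \<^term>\<open>q_bernoulli p q h r n\<close> is a polynomial in
  \<open>q\<close> raised to the sum of the variables, times a product of powers of \<open>q\<close>, hence a finite linear
  combination of products of exponentials \<open>x \<mapsto> (q powi a) ^ x\<close>. The integral only samples natural
  arguments, so everything reduces to one exponential in one variable. There the averages are
  geometric sums: with \<open>u = q ^ p ^ N\<close>, which tends to \<open>1\<close>, and \<open>b = a + 1\<close> they equal
  \<open>(q - 1) / (q powi b - 1)\<close> times \<open>(u powi b - 1) / (u - 1)\<close>, and the second factor tends to \<open>b\<close>.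
  For \<open>b = 0\<close> they equal \<open>(q - 1) * p ^ N / (u - 1)\<close>, whose limit involves the logarithm because
  \<open>(q ^ p ^ N - 1) / p ^ N\<close> tends to \<open>log q\<close> (\<open>p_adic_log_limit\<close>); this limit can be inverted
  because \<open>log q \<noteq> 0\<close> when \<open>q\<close> is not a root of unity (\<open>p_adic_log_neq_0\<close>). In all cases the
  integral is \<^term>\<open>q_quot q b\<close> (\<open>q_quot_limit\<close>).

  Consequently the Bernoulli numbers are the values of a linear functional on polynomials in one
  indeterminate \<open>X\<close>, standing for \<open>q\<close> to the sum of the variables: it sends \<open>X ^ i\<close> to
  \<^term>\<open>q_binom_quot q (h + int i - 1) r\<close>, and \<^term>\<open>q_bernoulli p q h r n\<close> is its value at \<open>B ^ n\<close>
  with \<open>B = (1 - X) / (1 - q)\<close> (\<open>q_bernoulli_eq_moment\<close>). Both kinds of identity now come from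
  the single relation \<open>X = (q - 1) * B + 1\<close>. Multiplication by \<open>X\<close> raises \<open>h\<close> by one, so
  applying the functional to \<open>X * B ^ n = (q - 1) * B ^ (n + 1) + B ^ n\<close> gives the recurrence, and
  applying it to the binomial expansion of \<open>X ^ n\<close> evaluates the sums.
\<close>

section \<open>Ultrametric absolute values\<close>

context p_adic_complex
begin

lemma absp_nonneg [simp]: "0 \<le> absp x"
  using dist_absp[of x 0] zero_le_dist[of x 0] by simp

lemma absp_eq_0_iff [simp]: "absp x = 0 \<longleftrightarrow> x = 0"
  using dist_absp[of x 0] dist_eq_0_iff[of x 0] by simp

lemma absp_0 [simp]: "absp 0 = 0"
  by simp

lemma absp_pos_iff [simp]: "0 < absp x \<longleftrightarrow> x \<noteq> 0"
  using absp_nonneg[of x] absp_eq_0_iff[of x] by linarith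

lemma absp_1 [simp]: "absp 1 = 1"
  using absp_mult[of 1 1] by simp

lemma absp_minus [simp]: "absp (- x) = absp x"
  using dist_absp[of 0 x] dist_absp[of x 0] by (simp add: dist_commute)

lemma absp_minus_commute: "absp (x - y) = absp (y - x)"
  by (metis absp_minus minus_diff_eq)

lemma absp_diff_le: "absp (x - y) \<le> max (absp x) (absp y)"
  using absp_ultrametric[of x "- y"] by simp

lemma absp_add_leI: "absp x \<le> B \<Longrightarrow> absp y \<le> B \<Longrightarrow> absp (x + y) \<le> B"
  using absp_ultrametric[of x y] by simp

lemma absp_diff_leI: "absp x \<le> B \<Longrightarrow> absp y \<le> B \<Longrightarrow> absp (x - y) \<le> B"
  using absp_diff_le[of x y] by simp

lemma absp_power: "absp (x ^ k) = absp x ^ k"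
  by (induction k) (simp_all add: absp_mult)

lemma absp_inverse: "absp (inverse x) = inverse (absp x)"
proof (cases "x = 0")
  case True
  then show ?thesis by simp
next
  case False
  then have "absp x * absp (inverse x) = 1" by (simp flip: absp_mult)
  then show ?thesis by (metis inverse_unique)
qed

lemma absp_divide: "absp (x / y) = absp x / absp y"
  by (simp add: divide_inverse absp_mult absp_inverse)

lemma absp_sum_le:
  assumes "\<And>i. i \<in> A \<Longrightarrow> absp (f i) \<le> B" "0 \<le> B"
  shows "absp (sum f A) \<le> B"
  using assms(1)
proof (induction A rule: infinite_finite_induct)
  case (insert i A)
  then show ?case by (simp add: absp_add_leI)
qed (use assms(2) in auto)

lemma absp_eq_of_absp_diff_less:
  assumes "absp (x - y) < absp y"
  shows "absp x = absp y"
proof (rule antisym)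
  show "absp x \<le> absp y"
    using absp_ultrametric[of "x - y" y] assms by simp
  show "absp y \<le> absp x"
    using absp_diff_le[of x "x - y"] assms by simp
qed

lemma absp_of_nat_le_1: "absp (of_nat k) \<le> 1"
proof (induction k)
  case 0
  show ?case by simp
next
  case (Suc k)
  then show ?case using absp_ultrametric[of 1 "of_nat k"] by simp
qed

lemma absp_of_int_le_1: "absp (of_int a) \<le> 1"
  using absp_of_nat_le_1 by (cases a rule: int_cases2) auto

lemma absp_gchoose_of_int_le_1: "absp (of_int a gchoose k) \<le> 1"
  by (subst of_int_gbinomial[symmetric]) (rule absp_of_int_le_1)

lemma absp_prime_power: "absp (of_nat (p ^ N)) = 1 / real p ^ N"
  by (simp add: absp_power absp_p power_divide)

text \<open>A Bezout relation writes \<open>1\<close> as the sum of a multiple of \<open>k\<close> and a multiple of \<open>p\<close>; the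
  latter is smaller than \<open>1\<close>, so the former has to carry the absolute value.\<close>

lemma absp_of_nat_coprime:
  assumes "\<not> p dvd k"
  shows "absp (of_nat k) = 1"
proof (rule antisym[OF absp_of_nat_le_1])
  have "coprime p k"
    using prime_p assms by (rule prime_imp_coprime)
  then have "coprime (int k) (int p)"
    by (simp add: coprime_commute)
  then obtain a b where ab: "a * int k + b * int p = 1"
    using bezout_int[of "int k" "int p"] by (auto simp: coprime_iff_gcd_eq_1)
  have bp: "absp (of_int b * of_nat p) < 1"
  proof -
    have "absp (of_int b * of_nat p) \<le> 1 * (1 / real p)"
      unfolding absp_mult absp_p by (intro mult_right_mono absp_of_int_le_1) simp
    also have "\<dots> < 1" using prime_gt_1_nat[OF prime_p] by simp
    finally show ?thesis .
  qed
  have "of_int a * of_nat k + of_int b * of_nat p = (1::'a)"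
    using arg_cong[OF ab, of "of_int :: int \<Rightarrow> 'a"] by simp
  then have "1 \<le> max (absp (of_int a * of_nat k)) (absp (of_int b * of_nat p))"
    using absp_ultrametric[of "of_int a * of_nat k" "of_int b * of_nat p"] by simp
  then have "1 \<le> absp (of_int a) * absp (of_nat k)"
    using bp by (simp add: absp_mult max_def split: if_splits)
  also have "\<dots> \<le> 1 * absp (of_nat k)"
    by (intro mult_right_mono absp_of_int_le_1) simp
  finally show "1 \<le> absp (of_nat k)" by simp
qed

text \<open>The absolute value of \<open>k\<close> is one over the largest power of \<open>p\<close> dividing \<open>k\<close>, and that power
  is at most \<open>k\<close>. This controls the denominators of the logarithm series.\<close>

lemma inverse_absp_of_nat_le:
  assumes "k > 0"
  shows "1 / absp (of_nat k) \<le> real k"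
  using assms
proof (induction k rule: less_induct)
  case (less k)
  show ?case
  proof (cases "p dvd k")
    case True
    then obtain m where m: "k = p * m" by auto
    have "m > 0" "m < k" using m less.prems prime_gt_1_nat[OF prime_p] by auto
    then have "real p * (1 / absp (of_nat m)) \<le> real p * real m"
      by (intro mult_left_mono less.IH) auto
    then show ?thesis by (simp add: m absp_mult absp_p)
  next
    case False
    then show ?thesis using absp_of_nat_coprime[OF False] less.prems by simp
  qed
qed

section \<open>Limits and series\<close>

text \<open>The type is merely a metric space that is also a field; continuity of its operations has to
  be derived from the absolute value.\<close>

lemma tendsto_absp_iff: "(f \<longlongrightarrow> l) F \<longleftrightarrow> ((\<lambda>x. absp (f x - l)) \<longlongrightarrow> 0) F"
  unfolding tendsto_dist_iff[of f] dist_absp ..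

lemma tendstoI_absp_le:
  assumes "\<forall>\<^sub>F x in F. absp (f x - l) \<le> g x" "(g \<longlongrightarrow> 0) F"
  shows "(f \<longlongrightarrow> l) F"
  unfolding tendsto_absp_iff
  by (rule tendsto_sandwich[OF _ assms(1) tendsto_const assms(2)]) simp

lemma tendsto_add_ultrametric:
  fixes l :: 'a
  assumes "(f \<longlongrightarrow> l) F" "(g \<longlongrightarrow> m) F"
  shows "((\<lambda>x. f x + g x) \<longlongrightarrow> l + m) F"
proof (rule tendstoI_absp_le)
  show "\<forall>\<^sub>F x in F. absp (f x + g x - (l + m)) \<le> max (absp (f x - l)) (absp (g x - m))"
    using absp_ultrametric by (simp add: add_diff_add)
  show "((\<lambda>x. max (absp (f x - l)) (absp (g x - m))) \<longlongrightarrow> 0) F"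
    using tendsto_max[of _ 0 F _ 0] assms by (simp add: tendsto_absp_iff)
qed

lemma tendsto_cmult_ultrametric:
  fixes l :: 'a
  assumes "(f \<longlongrightarrow> l) F"
  shows "((\<lambda>x. c * f x) \<longlongrightarrow> c * l) F"
  using assms unfolding tendsto_absp_iff right_diff_distrib[symmetric] absp_mult
  by (rule tendsto_mult_right_zero)

lemma tendsto_sum_ultrametric:
  fixes l :: "_ \<Rightarrow> 'a"
  assumes "\<And>i. i \<in> A \<Longrightarrow> ((\<lambda>x. f i x) \<longlongrightarrow> l i) F"
  shows "((\<lambda>x. \<Sum>i\<in>A. f i x) \<longlongrightarrow> (\<Sum>i\<in>A. l i)) F"
  using assms
  by (induction A rule: infinite_finite_induct) (simp_all add: tendsto_add_ultrametric)

lemma tendsto_inverse_ultrametric: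
  fixes l :: 'a
  assumes "(f \<longlongrightarrow> l) F" "l \<noteq> 0"
  shows "((\<lambda>x. inverse (f x)) \<longlongrightarrow> inverse l) F"
proof (rule tendstoI_absp_le)
  have *: "((\<lambda>x. absp (f x - l)) \<longlongrightarrow> 0) F"
    using assms(1) by (simp add: tendsto_absp_iff)
  have "0 < absp l"
    using assms(2) by simp
  then have "\<forall>\<^sub>F x in F. absp (f x - l) < absp l"
    by (rule order_tendstoD(2)[OF *])
  then show "\<forall>\<^sub>F x in F. absp (inverse (f x) - inverse l) \<le> absp (f x - l) / (absp l)\<^sup>2"
  proof eventually_elim
    case (elim x)
    have eq: "absp (f x) = absp l"
      by (rule absp_eq_of_absp_diff_less) (rule elim)
    then have "f x \<noteq> 0" using assms(2) by (metis absp_eq_0_iff)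
    then have "inverse (f x) - inverse l = (l - f x) / (f x * l)"
      using assms(2) by (simp add: field_simps)
    then show ?case
      using eq by (simp add: absp_divide absp_mult power2_eq_square absp_minus_commute[of l])
  qed
  show "((\<lambda>x. absp (f x - l) / (absp l)\<^sup>2) \<longlongrightarrow> 0) F"
    using * by (rule tendsto_divide_zero)
qed

text \<open>Over an ultrametric absolute value the tail of a series is no larger than its largest
  term, so terms tending to zero already force the partial sums to be Cauchy.\<close>

lemma summable_ultrametric:
  fixes f :: "nat \<Rightarrow> 'a"
  assumes bound: "\<And>k. absp (f k) \<le> g k" and "g \<longlonglongrightarrow> 0"
  shows "summable f"
proof -
  let ?S = "\<lambda>n. \<Sum>k<n. f k"
  have "Cauchy ?S"
  proof (rule metric_CauchyI)
    fix e :: real assume e: "0 < e"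
    have "\<forall>\<^sub>F k in sequentially. g k < e / 2"
      using e by (intro order_tendstoD(2)[OF assms(2)]) simp
    then obtain K where "\<And>k. k \<ge> K \<Longrightarrow> g k < e / 2"
      by (auto simp: eventually_sequentially)
    then have K: "absp (f k) < e / 2" if "k \<ge> K" for k
      using bound[of k] that by (meson le_less_trans)
    have *: "dist (?S m) (?S n) < e" if "K \<le> m" "m \<le> n" for m n
    proof -
      have "?S n = ?S m + (\<Sum>k=m..<n. f k)"
        using that by (simp add: lessThan_atLeast0 sum.atLeastLessThan_concat)
      then have "dist (?S m) (?S n) = absp (\<Sum>k=m..<n. f k)"
        by (simp add: dist_absp)
      also have "\<dots> \<le> e / 2"
        using K that e by (intro absp_sum_le) (auto simp: less_imp_le)
      finally show ?thesis using e by simp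
    qed
    show "\<exists>M. \<forall>m\<ge>M. \<forall>n\<ge>M. dist (?S m) (?S n) < e"
      by (metis * dist_commute nle_le)
  qed
  then obtain L where "?S \<longlonglongrightarrow> L"
    using complete_UNIV unfolding complete_def by auto
  then show ?thesis unfolding summable_def sums_def by blast
qed

end

section \<open>Powers of a principal unit\<close>

text \<open>The hypotheses that the definitions need in order to be meaningful: \<open>q\<close> lies in the open unit
  disc around \<open>1\<close> and is not a root of unity, so that no \<open>q\<close>-number of a nonzero integer vanishes.\<close>

locale p_adic_unit = p_adic_complex p absp
  for p :: nat and absp :: "'a::{field_char_0, metric_space} \<Rightarrow> real" +
  fixes q :: 'a
  assumes absp_one_minus_q: "absp (1 - q) < 1"
    and q_power_neq_1: "k > 0 \<Longrightarrow> q ^ k \<noteq> 1"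
begin

lemma absp_q_minus_1: "absp (q - 1) < 1"
  using absp_one_minus_q absp_minus_commute by simp

lemma absp_q [simp]: "absp q = 1"
  using absp_eq_of_absp_diff_less[of q 1] absp_q_minus_1 by simp

lemma q_neq_0 [simp]: "q \<noteq> 0"
  using absp_q absp_eq_0_iff by (metis zero_neq_one)

lemma q_neq_1 [simp]: "q \<noteq> 1"
  using q_power_neq_1[of 1] by simp

lemma q_powi_neq_1:
  assumes "b \<noteq> 0"
  shows "q powi b \<noteq> 1"
proof (cases "b > 0")
  case True
  then show ?thesis using q_power_neq_1[of "nat b"] by (simp add: power_int_def)
next
  case False
  then have "q powi b = inverse (q ^ nat (- b))" "nat (- b) > 0"
    using assms by (auto simp: power_int_def power_inverse)
  then show ?thesis using q_power_neq_1[of "nat (- b)"] by (metis inverse_inverse_eq inverse_1)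
qed

lemma q_pow_sums:
  "(\<lambda>k. (of_int a gchoose k) * (q - 1) ^ k) sums q_pow q (of_int a)"
  unfolding q_pow_def
proof (rule summable_sums, rule summable_ultrametric)
  show "absp ((of_int a gchoose k) * (q - 1) ^ k) \<le> absp (q - 1) ^ k" for k
    using absp_gchoose_of_int_le_1 by (simp add: absp_mult absp_power mult_left_le_one_le)
  show "(\<lambda>k. absp (q - 1) ^ k) \<longlonglongrightarrow> 0"
    using absp_q_minus_1 by (intro LIMSEQ_power_zero) simp
qed

text \<open>Pascal's rule turns the partial sums of the binomial series at \<^term>\<open>a + 1\<close> into those
  at \<^term>\<open>a\<close> multiplied by \<^term>\<open>1 + (q - 1)\<close>.\<close>

lemma q_pow_add_1: "q_pow q (of_int (a + 1)) = q * q_pow q (of_int a)"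
proof (rule LIMSEQ_unique)
  let ?S = "\<lambda>a K. \<Sum>k<K. (of_int a gchoose k) * (q - 1) ^ k"
  have lim: "?S a \<longlonglongrightarrow> q_pow q (of_int a)" for a
    using q_pow_sums by (simp add: sums_def)
  show "(\<lambda>K. ?S (a + 1) (Suc K)) \<longlonglongrightarrow> q_pow q (of_int (a + 1))"
    using lim by (rule LIMSEQ_Suc)
  have "?S (a + 1) (Suc K) = ?S a (Suc K) + (q - 1) * ?S a K" for K
  proof -
    have "?S (a + 1) (Suc K) = 1 + (\<Sum>k<K. (of_int a + 1 gchoose Suc k) * (q - 1) ^ Suc k)"
      by (subst sum.lessThan_Suc_shift) simp
    also have "\<dots> = 1 + (\<Sum>k<K. (of_int a gchoose Suc k) * (q - 1) ^ Suc k) + (q - 1) * ?S a K"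
      by (simp only: gbinomial_Suc_Suc distrib_right sum.distrib sum_distrib_left)
        (simp add: ac_simps)
    also have "1 + (\<Sum>k<K. (of_int a gchoose Suc k) * (q - 1) ^ Suc k) = ?S a (Suc K)"
      by (subst sum.lessThan_Suc_shift) simp
    finally show ?thesis .
  qed
  moreover have "(\<lambda>K. ?S a (Suc K) + (q - 1) * ?S a K)
      \<longlonglongrightarrow> q_pow q (of_int a) + (q - 1) * q_pow q (of_int a)"
    by (intro tendsto_add_ultrametric tendsto_cmult_ultrametric LIMSEQ_Suc lim)
  ultimately show "(\<lambda>K. ?S (a + 1) (Suc K)) \<longlonglongrightarrow> q * q_pow q (of_int a)"
    by (simp add: algebra_simps)
qed

text \<open>This identifies the binomial series with the algebraic power, in particular for the negative
  exponents \<open>h - j - 1\<close> in the definition of the Bernoulli numbers, where the series is infinite.\<close>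

lemma q_pow_of_int: "q_pow q (of_int a) = q powi a"
proof (induction a rule: int_induct[where k = 0])
  case base
  have "(\<lambda>k. (of_int 0 gchoose k) * (q - 1) ^ k) = (\<lambda>k. if k = 0 then 1 else 0)"
    by (auto simp: gbinomial_0_left)
  then have "(\<lambda>k. if k = 0 then 1 else 0) sums q_pow q (of_int 0)"
    using q_pow_sums[of 0] by simp
  moreover have "(\<lambda>k. if k = 0 then 1 else 0) sums (1 :: 'a)"
    by (rule sums_single)
  ultimately show ?case
    using sums_unique2 by (metis power_int_0_right)
next
  case (step1 a)
  then show ?case by (simp add: q_pow_add_1 power_int_add del: of_int_add)
next
  case (step2 a)
  have "q powi a = q * q powi (a - 1)"
    using power_int_add_1'[of q "a - 1"] by simp
  then show ?case
    using step2 q_pow_add_1[of "a - 1"] by simp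
qed

lemma q_pow_of_nat: "q_pow q (of_nat k) = q ^ k"
  using q_pow_of_int[of "int k"] by simp

lemma q_num_of_nat: "q_num q (of_nat k) = (1 - q ^ k) / (1 - q)"
  by (simp add: q_num_def q_pow_of_nat)

lemma q_num_of_int: "q_num q (of_int a) = (1 - q powi a) / (1 - q)"
  by (simp add: q_num_def q_pow_of_int)

section \<open>The logarithm as a limit\<close>

lemma absp_gchoose_prime_power_le:
  "absp (of_nat (p ^ N) gchoose Suc k) \<le> absp (of_nat (p ^ N)) * real (Suc k)"
proof -
  let ?M = "of_nat (p ^ N) :: 'a"
  have "?M gchoose Suc k = ?M / of_nat (Suc k) * (of_int (int (p ^ N) - 1) gchoose k)"
    by (subst gbinomial_absorption') simp_all
  then have "absp (?M gchoose Suc k) =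
      absp ?M * (1 / absp (of_nat (Suc k)) * absp (of_int (int (p ^ N) - 1) gchoose k))"
    by (simp only: absp_mult absp_divide) simp
  also have "\<dots> \<le> absp ?M * (real (Suc k) * 1)"
    by (intro mult_left_mono mult_mono inverse_absp_of_nat_le absp_gchoose_of_int_le_1) simp_all
  finally show ?thesis by simp
qed

text \<open>Dividing the binomial expansion of \<open>q ^ M - 1\<close> by \<open>M\<close> gives the logarithm series with
  \<open>(-1) ^ k\<close> replaced by \<open>(M - 1) gchoose k\<close>.  For \<open>M = p ^ N\<close> the two differ by an alternating
  sum of the numbers \<open>M gchoose j\<close> with \<open>0 < j \<le> k\<close>, each of which is small.\<close>

lemma absp_gchoose_prime_power_minus_1_le:
  "absp ((of_nat (p ^ N) - 1 gchoose k) - (- 1) ^ k) \<le> absp (of_nat (p ^ N)) * real (Suc k)"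
proof -
  let ?M = "of_nat (p ^ N) :: 'a"
  have "(- 1) ^ k * (?M - 1 gchoose k) = (\<Sum>j<Suc k. (?M gchoose j) * (- 1) ^ j)"
    using gbinomial_sum_lower_neg[of ?M k] by (simp only: lessThan_Suc_atMost)
  also have "\<dots> = 1 + (\<Sum>j<k. (?M gchoose Suc j) * (- 1) ^ Suc j)"
    by (subst sum.lessThan_Suc_shift) simp
  finally have "(- 1) ^ k * ((?M - 1 gchoose k) - (- 1) ^ k)
      = (\<Sum>j<k. (?M gchoose Suc j) * (- 1) ^ Suc j)"
    by (simp add: right_diff_distrib flip: power_mult_distrib)
  then have "absp ((?M - 1 gchoose k) - (- 1) ^ k)
      = absp (\<Sum>j<k. (?M gchoose Suc j) * (- 1) ^ Suc j)"
    by (metis absp_mult absp_power absp_minus absp_1 power_one mult_1)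
  also have "\<dots> \<le> absp ?M * real (Suc k)"
  proof (rule absp_sum_le)
    fix j assume "j \<in> {..<k}"
    then have "absp ?M * real (Suc j) \<le> absp ?M * real (Suc k)"
      by (intro mult_left_mono) auto
    then show "absp ((?M gchoose Suc j) * (- 1) ^ Suc j) \<le> absp ?M * real (Suc k)"
      using absp_gchoose_prime_power_le[of N j] by (simp only: absp_mult absp_power absp_minus absp_1 power_one mult_1_right)
  qed simp
  finally show ?thesis .
qed

lemma q_power_minus_1_divide:
  assumes "0 < M" "M \<le> K"
  shows "(q ^ M - 1) / of_nat M
    = (\<Sum>k<K. (of_nat M - 1 gchoose k) * (q - 1) ^ Suc k / of_nat (Suc k))"
proof -
  have "q ^ M = ((q - 1) + 1) ^ M" by simp
  also have "\<dots> = (\<Sum>k\<le>M. (of_nat M gchoose k) * (q - 1) ^ k)"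
    by (subst binomial_ring) (simp add: binomial_gbinomial)
  also have "\<dots> = (\<Sum>k<Suc K. (of_nat M gchoose k) * (q - 1) ^ k)"
    using assms by (intro sum.mono_neutral_left) (auto simp flip: binomial_gbinomial)
  also have "\<dots> = 1 + (\<Sum>k<K. (of_nat M gchoose Suc k) * (q - 1) ^ Suc k)"
    by (subst sum.lessThan_Suc_shift) simp
  also have "(\<Sum>k<K. (of_nat M gchoose Suc k) * (q - 1) ^ Suc k)
      = of_nat M * (\<Sum>k<K. (of_nat M - 1 gchoose k) * (q - 1) ^ Suc k / of_nat (Suc k))"
    by (subst sum_distrib_left, intro sum.cong refl) (simp add: gbinomial_absorption' del: of_nat_Suc)
  finally show ?thesis using assms by simp
qed

text \<open>One factor \<open>k + 1\<close> absorbs the denominator of the logarithm series, the other the estimate of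
  the coefficients; geometric decay beats both. The square root of the ratio distributes the decay
  over the two factors.\<close>

lemma log_term_bound:
  obtains C where "\<And>k. real (Suc k) ^ 2 * absp (q - 1) ^ Suc k \<le> C"
proof -
  define s where "s = sqrt (absp (q - 1))"
  have s: "0 \<le> s" "s < 1" "s\<^sup>2 = absp (q - 1)"
    using absp_q_minus_1 by (auto simp: s_def)
  have "(\<lambda>k. real k * s ^ k) \<longlonglongrightarrow> 0"
    using powser_times_n_limit_0[of s] s by simp
  then have "Bseq (\<lambda>k. real k * s ^ k)"
    by (intro convergent_imp_Bseq convergentI)
  then obtain D where "\<forall>k. norm (real k * s ^ k) \<le> D"
    by (rule BseqE)
  then have D: "\<bar>real k * s ^ k\<bar> \<le> D" for k
    by simp
  have "real (Suc k) ^ 2 * absp (q - 1) ^ Suc k \<le> D ^ 2" for k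
  proof -
    have "real (Suc k) ^ 2 * absp (q - 1) ^ Suc k = \<bar>real (Suc k) * s ^ Suc k\<bar> ^ 2"
      unfolding s(3)[symmetric] power2_abs by (simp only: power_mult_distrib mult.commute flip: power_mult)
    also have "\<dots> \<le> D ^ 2" by (intro power_mono D) simp
    finally show ?thesis .
  qed
  then show thesis by (rule that)
qed

lemma p_adic_log_sums:
  "(\<lambda>k. (- 1) ^ k * (q - 1) ^ Suc k / of_nat (Suc k)) sums p_adic_log q"
  unfolding p_adic_log_def
proof (rule summable_sums, rule summable_ultrametric)
  show "absp ((- 1) ^ k * (q - 1) ^ Suc k / of_nat (Suc k))
      \<le> real (Suc k) * absp (q - 1) ^ Suc k" for k
  proof -
    have "1 / absp (of_nat (Suc k)) * absp (q - 1) ^ Suc k \<le> real (Suc k) * absp (q - 1) ^ Suc k"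
      by (intro mult_right_mono inverse_absp_of_nat_le) simp_all
    then show ?thesis
      by (simp add: absp_mult absp_divide absp_power del: of_nat_Suc)
  qed
  show "(\<lambda>k. real (Suc k) * absp (q - 1) ^ Suc k) \<longlonglongrightarrow> 0"
    using absp_q_minus_1 LIMSEQ_Suc[OF powser_times_n_limit_0[of "absp (q - 1)"]] by simp
qed

lemma absp_prime_power_tendsto_0: "(\<lambda>N. absp (of_nat (p ^ N))) \<longlonglongrightarrow> 0"
proof -
  have "(\<lambda>N. (1 / real p) ^ N) \<longlonglongrightarrow> 0"
    using prime_gt_1_nat[OF prime_p] by (intro LIMSEQ_power_zero) simp
  then show ?thesis by (simp only: absp_prime_power power_divide power_one)
qed

text \<open>A single constant bounds, up to the factor \<open>absp (p ^ N)\<close>, all differences between the terms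
  of the expansion of \<open>(q ^ p ^ N - 1) / p ^ N\<close> and of the logarithm series. By the ultrametric
  inequality it also bounds the difference of the sums.\<close>

lemma p_adic_log_limit: "(\<lambda>N. (q ^ (p ^ N) - 1) / of_nat (p ^ N)) \<longlonglongrightarrow> p_adic_log q"
proof -
  obtain C where C: "\<And>k. real (Suc k) ^ 2 * absp (q - 1) ^ Suc k \<le> C"
    using log_term_bound by blast
  have C0: "0 \<le> C" by (rule order_trans[OF _ C[of 0]]) simp
  have bound: "absp ((q ^ (p ^ N) - 1) / of_nat (p ^ N) - p_adic_log q) \<le> absp (of_nat (p ^ N)) * C" for N
  proof -
    let ?M = "of_nat (p ^ N) :: 'a"
    let ?Y = "(q ^ (p ^ N) - 1) / ?M"
    let ?S = "\<lambda>K. \<Sum>k<K. (- 1) ^ k * (q - 1) ^ Suc k / of_nat (Suc k)"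
    \<comment> \<open>From index \<open>p ^ N\<close> on the partial sums contain the whole finite expansion of \<open>?Y\<close>.\<close>
    have partial: "dist ?Y (?S K) \<le> absp ?M * C" if "p ^ N \<le> K" for K
    proof -
      have "0 < p ^ N" using prime_gt_0_nat[OF prime_p] by simp
      then have "?Y - ?S K = (\<Sum>k<K. ((?M - 1 gchoose k) - (- 1) ^ k) * (q - 1) ^ Suc k / of_nat (Suc k))"
        using that by (subst q_power_minus_1_divide[where K = K])
          (simp_all add: left_diff_distrib diff_divide_distrib sum_subtractf)
      moreover have "absp (((?M - 1 gchoose k) - (- 1) ^ k) * (q - 1) ^ Suc k / of_nat (Suc k))
          \<le> absp ?M * C" for k
      proof -
        have "absp (((?M - 1 gchoose k) - (- 1) ^ k) * (q - 1) ^ Suc k / of_nat (Suc k))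
            = absp ((?M - 1 gchoose k) - (- 1) ^ k) * (absp (q - 1) ^ Suc k * (1 / absp (of_nat (Suc k))))"
          by (simp only: absp_mult absp_divide absp_power) simp
        also have "\<dots> \<le> (absp ?M * real (Suc k)) * (absp (q - 1) ^ Suc k * real (Suc k))"
          by (intro mult_mono mult_left_mono inverse_absp_of_nat_le
                absp_gchoose_prime_power_minus_1_le) simp_all
        also have "\<dots> = absp ?M * (real (Suc k) ^ 2 * absp (q - 1) ^ Suc k)"
          by (simp only: power2_eq_square mult_ac)
        also have "\<dots> \<le> absp ?M * C" by (intro mult_left_mono C) simp
        finally show ?thesis .
      qed
      ultimately show ?thesis
        using C0 by (simp only: dist_absp) (intro absp_sum_le, simp_all)
    qed
    have "(\<lambda>K. dist ?Y (?S K)) \<longlonglongrightarrow> dist ?Y (p_adic_log q)"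
      using p_adic_log_sums by (intro tendsto_dist tendsto_const) (simp add: sums_def)
    then have "dist ?Y (p_adic_log q) \<le> absp ?M * C"
      by (rule LIMSEQ_le_const2) (use partial in blast)
    then show ?thesis by (simp add: dist_absp)
  qed
  show ?thesis
  proof (rule tendstoI_absp_le)
    show "\<forall>\<^sub>F N in sequentially. absp ((q ^ (p ^ N) - 1) / of_nat (p ^ N) - p_adic_log q)
        \<le> absp (of_nat (p ^ N)) * C"
      using bound by simp
    show "(\<lambda>N. absp (of_nat (p ^ N)) * C) \<longlonglongrightarrow> 0"
      using absp_prime_power_tendsto_0 by (rule tendsto_mult_left_zero)
  qed
qed

lemma q_prime_power_tendsto_1: "(\<lambda>N. absp (q ^ (p ^ N) - 1)) \<longlonglongrightarrow> 0"
proof -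
  have "(\<lambda>N. absp ((q ^ (p ^ N) - 1) / of_nat (p ^ N))) \<longlonglongrightarrow> absp (p_adic_log q)"
    using tendsto_dist[OF p_adic_log_limit tendsto_const[of 0]] by (simp add: dist_absp)
  from tendsto_mult[OF absp_prime_power_tendsto_0 this] show ?thesis
    using prime_gt_0_nat[OF prime_p] by (simp flip: absp_mult)
qed

text \<open>The derivative of \<open>u \<mapsto> u powi b\<close> at \<open>1\<close> is \<open>b\<close>, with an error that is quadratic without any
  constant because the coefficients are integers. Passing between \<open>b\<close> and \<open>b + 1\<close> multiplies the
  error by \<open>u\<close> and adds \<open>b * (u - 1) ^ 2\<close>, which works in both directions.\<close>

lemma absp_powi_minus_linear_le:
  assumes "absp u = 1"
  shows "absp (u powi b - 1 - of_int b * (u - 1)) \<le> absp (u - 1) ^ 2"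
proof (induction b rule: int_induct[where k = 0])
  case base
  show ?case by simp
next
  case (step1 b)
  have "u \<noteq> 0" using assms absp_eq_0_iff by (metis zero_neq_one)
  then have "u powi (b + 1) = u * u powi b"
    by (simp add: power_int_add_1')
  then have "u powi (b + 1) - 1 - of_int (b + 1) * (u - 1)
      = u * (u powi b - 1 - of_int b * (u - 1)) + of_int b * (u - 1) ^ 2"
    by (simp only:) (simp add: algebra_simps power2_eq_square)
  moreover have "absp (u * (u powi b - 1 - of_int b * (u - 1))) \<le> absp (u - 1) ^ 2"
    using step1 assms by (simp add: absp_mult)
  moreover have "absp (of_int b * (u - 1) ^ 2) \<le> absp (u - 1) ^ 2"
    using absp_of_int_le_1[of b] by (simp add: absp_mult absp_power mult_left_le_one_le)
  ultimately show ?case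
    by (simp only: absp_add_leI)
next
  case (step2 b)
  have u0: "u \<noteq> 0" using assms absp_eq_0_iff by (metis zero_neq_one)
  define c where "c = b - 1"
  have b: "b = c + 1" by (simp add: c_def)
  have "u powi b = u * u powi c"
    unfolding b using u0 by (simp add: power_int_add_1')
  moreover have "of_int b = (of_int c + 1 :: 'a)"
    by (simp add: b)
  ultimately have "u * (u powi c - 1 - of_int c * (u - 1))
      = (u powi b - 1 - of_int b * (u - 1)) - of_int c * (u - 1) ^ 2"
    by (simp only:) (simp add: algebra_simps power2_eq_square)
  moreover have "absp (of_int c * (u - 1) ^ 2) \<le> absp (u - 1) ^ 2"
    using absp_of_int_le_1[of c] by (simp add: absp_mult absp_power mult_left_le_one_le)
  ultimately have "absp (u * (u powi c - 1 - of_int c * (u - 1))) \<le> absp (u - 1) ^ 2"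
    using step2 by (simp only: absp_diff_leI)
  then show ?case using assms by (simp add: absp_mult c_def)
qed

text \<open>Once \<open>q ^ p ^ N\<close> is close enough to \<open>1\<close>, each further \<open>p\<close>-th power divides its distance
  to \<open>1\<close> by exactly \<open>p\<close>, so the quotients converging to the logarithm have constant, nonzero
  absolute value from then on.\<close>

lemma p_adic_log_neq_0: "p_adic_log q \<noteq> 0"
proof
  assume log0: "p_adic_log q = 0"
  let ?u = "\<lambda>N. q ^ (p ^ N)"
  let ?Y = "\<lambda>N. absp ((?u N - 1) / of_nat (p ^ N))"
  have p: "real p > 1" "p > 0" using prime_gt_1_nat[OF prime_p] by simp_all
  have "\<forall>\<^sub>F N in sequentially. absp (?u N - 1) < 1 / real p"
    using p by (intro order_tendstoD(2)[OF q_prime_power_tendsto_1]) simp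
  then obtain K where K: "\<And>N. N \<ge> K \<Longrightarrow> absp (?u N - 1) < 1 / real p"
    by (auto simp: eventually_sequentially)
  have step: "?Y (Suc N) = ?Y N" if "N \<ge> K" for N
  proof -
    let ?d = "?u N - 1"
    have d: "0 < absp ?d" using q_power_neq_1[of "p ^ N"] p by simp
    \<comment> \<open>The linear term \<open>p * ?d\<close> has absolute value \<open>absp ?d / p\<close>, which dominates the quadratic
       error exactly because \<open>absp ?d < 1 / p\<close>.\<close>
    have "absp (?u N powi int p - 1 - of_int (int p) * ?d) \<le> absp ?d ^ 2"
      by (rule absp_powi_minus_linear_le) (simp add: absp_power)
    also have "\<dots> < absp (of_nat p * ?d)"
      using mult_strict_right_mono[OF K[OF that] d] by (simp add: absp_mult absp_p power2_eq_square)
    finally have "absp (?u N ^ p - 1) = absp (of_nat p * ?d)"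
      by (intro absp_eq_of_absp_diff_less) simp
    then have "absp (?u (Suc N) - 1) = absp (of_nat p * ?d)"
      by (simp add: mult.commute flip: power_mult)
    then show ?thesis
      using p by (simp add: absp_divide absp_mult absp_p)
  qed
  have const: "?Y N = ?Y K" if "N \<ge> K" for N
    using that by (induction N rule: dec_induct) (simp_all only: step)
  have "?Y \<longlonglongrightarrow> 0"
    using p_adic_log_limit unfolding log0 tendsto_absp_iff by simp
  moreover have "?Y \<longlonglongrightarrow> ?Y K"
    by (rule tendsto_eventually, rule eventually_sequentiallyI[of K], rule const)
  ultimately have "?Y K = 0" by (rule LIMSEQ_unique[symmetric])
  then show False using q_power_neq_1[of "p ^ K"] p by simp
qed

section \<open>The integral of a power function\<close>

lemma q_quot_limit:
  "(\<lambda>N. 1 / q_num q (of_nat (p ^ N)) * (\<Sum>k<p ^ N. (q powi b) ^ k)) \<longlonglongrightarrow> q_quot q b"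
proof (cases "b = 0")
  case True
  have "(\<lambda>N. (q - 1) * inverse ((q ^ (p ^ N) - 1) / of_nat (p ^ N)))
      \<longlonglongrightarrow> (q - 1) * inverse (p_adic_log q)"
    by (intro tendsto_cmult_ultrametric tendsto_inverse_ultrametric p_adic_log_limit p_adic_log_neq_0)
  moreover have "1 / q_num q (of_nat (p ^ N)) * (\<Sum>k<p ^ N. (q powi b) ^ k)
      = (q - 1) * inverse ((q ^ (p ^ N) - 1) / of_nat (p ^ N))" for N
  proof -
    have "(1 - q) / (1 - q ^ (p ^ N)) = (q - 1) / (q ^ (p ^ N) - 1)"
      by (metis minus_diff_eq minus_divide_divide)
    then show ?thesis
      unfolding q_num_of_nat using True by (simp add: divide_inverse mult_ac)
  qed
  moreover have "q_quot q b = (q - 1) * inverse (p_adic_log q)"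
    using True by (simp add: q_quot_def divide_inverse)
  ultimately show ?thesis by (simp only:)
next
  case False
  define c where "c = (1 - q) / (1 - q powi b)"
  have nz: "1 - q powi b \<noteq> 0" using q_powi_neq_1[OF False] by simp
  have lim: "q_quot q b = c * of_int b"
    using False nz by (simp add: q_quot_def q_num_of_int c_def)
  show ?thesis
  proof (rule tendstoI_absp_le, intro always_eventually allI)
    fix N
    define u where "u = q ^ (p ^ N)"
    have u1: "u - 1 \<noteq> 0"
      using q_power_neq_1[of "p ^ N"] prime_gt_0_nat[OF prime_p] by (simp add: u_def)
    have "(\<Sum>k<p ^ N. (q powi b) ^ k) = (u powi b - 1) / (q powi b - 1)"
      unfolding u_def using q_powi_neq_1[OF False]
      by (subst geometric_sum) (simp_all add: power_int_power power_int_power' mult.commute)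
    moreover have "q_num q (of_nat (p ^ N)) = (u - 1) / (q - 1)"
      unfolding q_num_of_nat u_def by (metis minus_diff_eq minus_divide_divide)
    moreover have "c = (q - 1) / (q powi b - 1)"
      unfolding c_def by (metis minus_diff_eq minus_divide_divide)
    ultimately have "1 / q_num q (of_nat (p ^ N)) * (\<Sum>k<p ^ N. (q powi b) ^ k)
        = c * ((u powi b - 1) / (u - 1))"
      by (simp only:) (simp add: divide_inverse mult_ac)
    then have "1 / q_num q (of_nat (p ^ N)) * (\<Sum>k<p ^ N. (q powi b) ^ k) - q_quot q b
        = c * ((u powi b - 1 - of_int b * (u - 1)) / (u - 1))"
      using u1 by (simp add: lim field_simps)
    also have "absp \<dots> \<le> absp c * (absp (u - 1) ^ 2 / absp (u - 1))"
      unfolding absp_mult absp_divide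
      by (intro mult_left_mono divide_right_mono absp_powi_minus_linear_le)
        (simp_all add: u_def absp_power)
    finally show "absp (1 / q_num q (of_nat (p ^ N)) * (\<Sum>k<p ^ N. (q powi b) ^ k) - q_quot q b)
        \<le> absp c * absp (q ^ (p ^ N) - 1)"
      using u1 by (simp add: u_def power2_eq_square)
  next
    show "(\<lambda>N. absp c * absp (q ^ (p ^ N) - 1)) \<longlonglongrightarrow> 0"
      using q_prime_power_tendsto_1 by (rule tendsto_mult_right_zero)
  qed
qed

text \<open>The weight \<open>q ^ x\<close> of the measure turns the exponent \<open>a i\<close> into \<open>a i + 1\<close>.\<close>

lemma q_integral_exponential_sum:
  assumes "\<And>k. g (of_nat k) = (\<Sum>i\<in>A. c i * (q powi a i) ^ k)"
  shows "q_integral p q g = (\<Sum>i\<in>A. c i * q_quot q (a i + 1))"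
  unfolding q_integral_def
proof (rule limI)
  have "1 / q_num q (of_nat (p ^ N)) * (\<Sum>k<p ^ N. g (of_nat k) * q_pow q (of_nat k))
      = (\<Sum>i\<in>A. c i * (1 / q_num q (of_nat (p ^ N)) * (\<Sum>k<p ^ N. (q powi (a i + 1)) ^ k)))" for N
  proof -
    have "(\<Sum>k<p ^ N. g (of_nat k) * q_pow q (of_nat k))
        = (\<Sum>k<p ^ N. \<Sum>i\<in>A. c i * (q powi (a i + 1)) ^ k)"
      by (simp add: assms q_pow_of_nat sum_distrib_right power_int_add_1 power_mult_distrib mult.assoc)
    also have "\<dots> = (\<Sum>i\<in>A. c i * (\<Sum>k<p ^ N. (q powi (a i + 1)) ^ k))"
      by (subst sum.swap) (simp add: sum_distrib_left)
    finally show ?thesis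
      by (simp only: sum_distrib_left mult.left_commute[of "1 / q_num q (of_nat (p ^ N))"])
  qed
  then show "(\<lambda>N. 1 / q_num q (of_nat (p ^ N)) * (\<Sum>k<p ^ N. g (of_nat k) * q_pow q (of_nat k)))
      \<longlonglongrightarrow> (\<Sum>i\<in>A. c i * q_quot q (a i + 1))"
    by (simp only:) (intro tendsto_sum_ultrametric tendsto_cmult_ultrametric q_quot_limit)
qed

text \<open>Linear combinations, rather than single products, are needed throughout: they are stable under
  integrating out one variable, whose exponentials are absorbed into the coefficients.\<close>

lemma q_integral_iter_exponential_sum:
  assumes "\<And>m. g (\<lambda>j. of_nat (m j)) = (\<Sum>i\<in>A. c i * (\<Prod>j=1..r. (q powi a i j) ^ m j))"
  shows "q_integral_iter p q r g = (\<Sum>i\<in>A. c i * (\<Prod>j=1..r. q_quot q (a i j + 1)))"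
  using assms
proof (induction r arbitrary: g c)
  case 0
  show ?case using "0"[of "\<lambda>_. 0"] by simp
next
  case (Suc r)
  define inner where "inner = (\<lambda>y. q_integral_iter p q r (\<lambda>x. g (x(Suc r := y))))"
  have "inner (of_nat k)
      = (\<Sum>i\<in>A. (c i * (\<Prod>j=1..r. q_quot q (a i j + 1))) * (q powi a i (Suc r)) ^ k)" for k
  proof -
    have "inner (of_nat k)
        = (\<Sum>i\<in>A. (c i * (q powi a i (Suc r)) ^ k) * (\<Prod>j=1..r. q_quot q (a i j + 1)))"
      unfolding inner_def
    proof (rule Suc.IH)
      fix m :: "nat \<Rightarrow> nat"
      have "(\<lambda>j. of_nat (m j))(Suc r := of_nat k) = (\<lambda>j. of_nat ((m(Suc r := k)) j) :: 'a)"
        by auto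
      moreover have "(\<Prod>j=1..r. (q powi a i j) ^ (m(Suc r := k)) j) = (\<Prod>j=1..r. (q powi a i j) ^ m j)" for i
        by (intro prod.cong) auto
      ultimately show "g ((\<lambda>j. of_nat (m j))(Suc r := of_nat k))
          = (\<Sum>i\<in>A. (c i * (q powi a i (Suc r)) ^ k) * (\<Prod>j=1..r. (q powi a i j) ^ m j))"
        by (simp only: Suc.prems) (simp only: prod.cl_ivl_Suc, simp add: mult_ac)
    qed
    then show ?thesis by (simp add: mult_ac)
  qed
  then have "q_integral p q inner
      = (\<Sum>i\<in>A. (c i * (\<Prod>j=1..r. q_quot q (a i j + 1))) * q_quot q (a i (Suc r) + 1))"
    by (rule q_integral_exponential_sum)
  then show ?case by (simp add: inner_def mult_ac)
qed

section \<open>Bernoulli numbers as moments\<close>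

text \<open>The integral of \<open>f (q ^ (x\<^sub>1 + \<dots> + x\<^sub>r))\<close> against the weight \<open>q ^ (\<Sum>j. (h - j - 1) * x\<^sub>j)\<close>,
  given in closed form: the monomial \<open>X ^ i\<close> shifts \<open>h\<close> by \<open>i\<close>, and the \<open>r\<close> variables contribute
  the factors \<^term>\<open>q_quot q (h + int i - int j)\<close>.\<close>

definition moment :: "int \<Rightarrow> nat \<Rightarrow> 'a poly \<Rightarrow> 'a" where
  "moment h r f = (\<Sum>i\<le>degree f. coeff f i * q_binom_quot q (h + int i - 1) r)"

lemma moment_eq_sum:
  assumes "degree f \<le> N"
  shows "moment h r f = (\<Sum>i\<le>N. coeff f i * q_binom_quot q (h + int i - 1) r)"
  unfolding moment_def using assms
  by (intro sum.mono_neutral_left) (auto simp: coeff_eq_0)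

lemma moment_add: "moment h r (f + g) = moment h r f + moment h r g"
proof -
  let ?N = "max (degree f) (degree g)"
  have "degree (f + g) \<le> ?N" by (rule degree_add_le_max)
  then show ?thesis
    by (simp add: moment_eq_sum[of _ ?N] sum.distrib distrib_right)
qed

lemma moment_smult: "moment h r (smult c f) = c * moment h r f"
  by (simp add: moment_eq_sum[OF degree_smult_le] moment_def sum_distrib_left mult.assoc)

lemma moment_sum: "moment h r (\<Sum>i\<in>A. f i) = (\<Sum>i\<in>A. moment h r (f i))"
  by (induction A rule: infinite_finite_induct)
    (simp_all add: moment_add, simp_all add: moment_def)

lemma moment_pCons_0: "moment h r (pCons 0 f) = moment (h + 1) r f"
proof -
  have "degree (pCons 0 f) \<le> Suc (degree f)" by (rule degree_pCons_le)
  then show ?thesis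
    by (simp add: moment_eq_sum[of _ "Suc (degree f)"] moment_def sum.atMost_Suc_shift add_ac
        del: sum.atMost_Suc)
qed

lemma moment_monom: "moment h r (monom 1 n) = q_binom_quot q (h + int n - 1) r"
proof -
  have "moment h r (monom 1 n) = (\<Sum>i\<le>n. if n = i then q_binom_quot q (h + int i - 1) r else 0)"
    by (subst moment_eq_sum[of _ n], simp add: degree_monom_eq, intro sum.cong) simp_all
  then show ?thesis by simp
qed

text \<open>The \<open>q\<close>-number of \<open>x\<close> as a polynomial in \<open>q ^ x\<close>.\<close>

definition q_num_poly :: "'a poly" where
  "q_num_poly = [:1 / (1 - q), - 1 / (1 - q):]"

text \<open>The relation \<open>q ^ x = (q - 1) * [x] + 1\<close>, the common source of all the identities.\<close>

lemma smult_q_num_poly: "smult (q - 1) q_num_poly + 1 = [:0, 1:]"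
proof -
  have "(q - 1) / (1 - q) = - 1"
    by (simp add: divide_eq_eq)
  then show ?thesis by (simp add: q_num_poly_def one_pCons)
qed

lemma q_bernoulli_eq_moment: "q_bernoulli p q h r n = moment h r (q_num_poly ^ n)"
proof -
  let ?B = "q_num_poly ^ n"
  let ?a = "\<lambda>i j. h - int j - 1 + int i"
  have "q_bernoulli p q h r n
      = (\<Sum>i\<le>degree ?B. coeff ?B i * (\<Prod>j=1..r. q_quot q (?a i j + 1)))"
    unfolding q_bernoulli_def
  proof (rule q_integral_iter_exponential_sum)
    fix m :: "nat \<Rightarrow> nat"
    let ?s = "\<Sum>j=1..r. m j"
    have weight: "q_pow q (\<Sum>j=1..r. of_int (h - int j - 1) * of_nat (m j))
        = (\<Prod>j=1..r. (q powi (h - int j - 1)) ^ m j)"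
    proof -
      have "(\<Sum>j=1..r. of_int (h - int j - 1) * of_nat (m j))
          = (of_int (\<Sum>j=1..r. (h - int j - 1) * int (m j)) :: 'a)"
        by simp
      moreover have "q powi (\<Sum>j=1..r. f j) = (\<Prod>j=1..r. q powi f j)" for f :: "nat \<Rightarrow> int"
        by (induction r) (simp_all add: power_int_add)
      ultimately show ?thesis
        by (simp only: q_pow_of_int power_int_power')
    qed
    have "q_num q (\<Sum>j=1..r. of_nat (m j)) = q_num q (of_nat ?s)"
      by simp
    also have "\<dots> = poly q_num_poly (q ^ ?s)"
      by (simp only: q_num_of_nat) (simp add: q_num_poly_def diff_divide_distrib)
    finally have "q_num q (\<Sum>j=1..r. of_nat (m j)) ^ n = poly ?B (q ^ ?s)"
      by simp
    also have "\<dots> = (\<Sum>i\<le>degree ?B. coeff ?B i * (\<Prod>j=1..r. (q powi int i) ^ m j))"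
      by (simp add: poly_altdef power_sum prod_power_distrib mult.commute flip: power_mult)
    finally have "q_pow q (\<Sum>j=1..r. of_int (h - int j - 1) * of_nat (m j))
        * q_num q (\<Sum>j=1..r. of_nat (m j)) ^ n
      = (\<Sum>i\<le>degree ?B. coeff ?B i *
          ((\<Prod>j=1..r. (q powi (h - int j - 1)) ^ m j) * (\<Prod>j=1..r. (q powi int i) ^ m j)))"
      by (simp only: weight sum_distrib_left
          mult.left_commute[of "\<Prod>j=1..r. (q powi (h - int j - 1)) ^ m j"])
    also have "\<dots> = (\<Sum>i\<le>degree ?B. coeff ?B i * (\<Prod>j=1..r. (q powi ?a i j) ^ m j))"
      by (simp only: power_int_add q_neq_0 simp_thms power_mult_distrib prod.distrib)
    finally show "q_pow q (\<Sum>j=1..r. of_int (h - int j - 1) * of_nat (m j))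
        * q_num q (\<Sum>j=1..r. of_nat (m j)) ^ n
      = (\<Sum>i\<le>degree ?B. coeff ?B i * (\<Prod>j=1..r. (q powi ?a i j) ^ m j))" .
  qed
  also have "\<dots> = moment h r ?B"
    unfolding moment_def q_binom_quot_def
    by (intro sum.cong prod.cong arg_cong2[where f = "(*)"] refl) (simp add: algebra_simps)
  finally show ?thesis .
qed

lemma q_bernoulli_recurrence:
  "q_bernoulli p q h r n
    = (q - 1) * q_bernoulli p q (h - 1) r (n + 1) + q_bernoulli p q (h - 1) r n"
proof -
  have "pCons 0 (q_num_poly ^ n) = [:0, 1:] * q_num_poly ^ n"
    by simp
  also have "\<dots> = smult (q - 1) (q_num_poly ^ (n + 1)) + q_num_poly ^ n"
    by (simp add: smult_q_num_poly[symmetric] distrib_right del: mult_pCons_left)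
  finally have "moment (h - 1) r (pCons 0 (q_num_poly ^ n))
      = (q - 1) * moment (h - 1) r (q_num_poly ^ (n + 1)) + moment (h - 1) r (q_num_poly ^ n)"
    by (simp only: moment_add moment_smult)
  then show ?thesis
    by (simp add: moment_pCons_0 q_bernoulli_eq_moment)
qed

lemma q_bernoulli_binomial_sum:
  "(\<Sum>l=0..n. of_nat (n choose l) * (q - 1) ^ l * q_bernoulli p q h r l)
    = q_binom_quot q (h + int n - 1) r"
proof -
  have "monom 1 n = (smult (q - 1) q_num_poly + 1) ^ n"
    by (simp add: smult_q_num_poly monom_altdef)
  also have "\<dots> = (\<Sum>l\<le>n. smult (of_nat (n choose l) * (q - 1) ^ l) (q_num_poly ^ l))"
    by (simp add: binomial_ring smult_power of_nat_poly mult.commute)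
  finally have "moment h r (monom 1 n)
      = (\<Sum>l\<le>n. of_nat (n choose l) * (q - 1) ^ l * moment h r (q_num_poly ^ l))"
    by (simp only: moment_sum moment_smult)
  then show ?thesis
    by (simp add: moment_monom q_bernoulli_eq_moment atLeast0AtMost)
qed

end

theorem theorem5:
  fixes p :: nat and absp :: "'a::{field_char_0, metric_space} \<Rightarrow> real"
    and q :: 'a and h :: int and r n :: nat
  assumes "p_adic_complex p absp"
    and "absp (1 - q) < 1"
    and "\<forall>k>0. q ^ k \<noteq> 1"
    and "r \<ge> 1"
  shows "q_bernoulli p q h r n =
           (q - 1) * q_bernoulli p q (h - 1) r (n + 1) + q_bernoulli p q (h - 1) r n
       \<and> (\<Sum>l=0..n. of_nat (n choose l) * (q - 1) ^ l * q_bernoulli p q 0 r l) =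
           q_binom_quot q (int n - 1) r
       \<and> (\<Sum>l=0..n. of_nat (n choose l) * (q - 1) ^ l * q_bernoulli p q h 1 l) =
           q_quot q (int n + h - 1)"
proof -
  interpret p_adic_complex p absp by fact
  interpret p_adic_unit p absp q
    by unfold_locales (use assms in auto)
  have "q_binom_quot q (h + int n - 1) 1 = q_quot q (int n + h - 1)"
    by (simp add: q_binom_quot_def add.commute)
  then show ?thesis
    using q_bernoulli_recurrence[of h r n] q_bernoulli_binomial_sum[of n 0 r]
      q_bernoulli_binomial_sum[of n h 1] by simp
qed

end
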